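(* Let $T\in(0,\infty)$, $p\in(0,1)$, $\alpha,\nu\in(0,1]$ and $\rho\in[0,1]$. Let $q:[0,T]\to(0,1]$ be a decreasing function with $q(T)=p$ such that $$F(t)=\frac{\frac{1}{q(t)}-1}{\frac1p-1},\quad t\in[0,T],$$ is a distribution function with $F(0)=0$ and $F(T)=1$. Let $N_\rho^{\alpha,\nu}(\cdot)=\{N_\rho^{\alpha,\nu}(t):t\in[0,T]\}$ be the correlated counting process $N_\rho(\cdot)$ (see context) for which $F$ is the common distribution function of the random variables $X_n^{F,\rho}$ and the probability generating function of $M_g$ is (case $r=1$) $$g(u)=E_{\nu,1}\left(-\log^\alpha\left(\frac{1-(1-p)u}{p}\right)\right),\quad |u|<\frac{1}{1-p}.$$ Then the probability mass functions $\{P(N_\rho^{\alpha,\nu}(t)=\cdot):t\in[0,T]\}$ are, for all integers $k\ge0$, $$P(N_\rho^{\alpha,\nu}(t)=k)=(1-\rho)P(N_0^{\alpha,\nu}(t)=k)+\rho\left\{\frac{\frac{1}{p}-\frac{1}{q(t)}}{\frac{1}{p}-1}1_{k=0}+\frac{\frac{1}{q(t)}-1}{\frac{1}{p}-1}P(N_0^{\alpha,\nu}(T)=k)\right\},$$ where, for all $t\in[0,T]$ and with $A_t=\frac{1}{q(t)}-1$, $$P(N_0^{\alpha,\nu}(t)=0)=E_{\nu,1}\left(-\log^\alpha(1+A_t)\right)$$ and, for $k\ge1$, $$P(N_0^{\alpha,\nu}(t)=k)=\frac{1}{k!}\frac{(-A_t)^k}{(1+A_t)^k}\sum_{h=1}^k\log^{-h}(1+A_t)\,s_{k,h}\cdot{}_2\Psi_2\left[\begin{array}{cc}(1,\alpha)&(1,1)\\(1-h,\alpha)&(1,\nu)\end{array}\right]\left(-\log^\alpha(1+A_t)\right).$$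 (The convergence condition for the Fox-Wright function ${}_2\Psi_2$ recalled in the context holds because $\alpha+\nu-(\alpha+1)=\nu-1>-1$.)
   Context: $\log^\alpha(x)$ means $(\log x)^\alpha$, and $\log^{-h}(x)=(\log x)^{-h}$; $1_{k=0}$ is $1$ if $k=0$ and $0$ otherwise. Mittag-Leffler function: $E_{\alpha,\beta}(x)=\sum_{j\ge 0}\frac{x^j}{\Gamma(\alpha j+\beta)}$. Stirling numbers: $\{s_{k,h}:k\ge h\ge0\}$ are the (signed) Stirling numbers of the first kind, so that $s_{k,k}=1$, $s_{k,0}=0$ for $k\ge1$, and $s_{k+1,h}=s_{k,h-1}-k\,s_{k,h}$ for $1\le h\le k$. Fox-Wright function: $${}_p\Psi_q\left[\begin{array}{c}(a_1,\alpha_1)\ldots(a_p,\alpha_p)\\(b_1,\beta_1)\ldots(b_q,\beta_q)\end{array}\right](z)=\sum_{j\ge0}\frac{\prod_{h=1}^p\Gamma(a_h+\alpha_hj)}{\prod_{k=1}^q\Gamma(b_k+\beta_kj)}\frac{z^j}{j!},$$ under the convergence condition $\sum_{k=1}^q\beta_k-\sum_{h=1}^p\alpha_h>-1$, with the usual reading $1/\Gamma(x)=0$ for $x\in\{0,-1,-2,\ldots\}$. (In this definition $p,q$ are integers unrelated to the parameter $p$ and the function $q$ of the claim.) Correlated counting process: for $\rho\in[0,1]$ and $T\in(0,\infty)$, $N_\rho(t)=\sum_{n=1}^{M_g}1_{[0,t]}(X_n^{F,\rho})$, $t\in[0,T]$, where $M_g$ is a nonnegative integer valued random variable with probability generating function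 $g(u)=\mathbb{E}[u^{M_g}]$, and $\{X_n^{F,\rho}:n\ge1\}$ is a sequence of random variables, independent of $M_g$, with common distribution function $F$ such that $F(0)=0$, $F(T)=1$, and with common pairwise correlation coefficient $\rho$. The dependence structure is the one for which, for each $t\in[0,T]$, the law of $N_\rho(t)$ is given by the following formulas (recalled from the literature and used as standing facts about these processes): the probability generating function is $$G_{N_\rho(t)}(u)=\rho(1-F(t))+\rho F(t)g(u)+(1-\rho)g(1-F(t)+F(t)u),$$ and, for all $k\ge0$, $$P(N_\rho(t)=k)=(1-\rho)P(N_0(t)=k)+\rho\{(1-F(t))1_{k=0}+F(t)P(M_g=k)\},$$ $$P(N_0(t)=k)=\sum_{n=k}^\infty\binom{n}{k}F^k(t)(1-F(t))^{n-k}P(M_g=n).$$ *)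

theory Defs
  imports "HOL-Probability.Probability" "HOL-Combinatorics.Stirling"
begin

subsection \<open>Special functions and numbers\<close>

definition mittag_leffler :: "real \<Rightarrow> real \<Rightarrow> real \<Rightarrow> real" where
  "mittag_leffler \<alpha> \<beta> x = (\<Sum>j. x ^ j / Gamma (\<alpha> * real j + \<beta>))"

text \<open>
  The denominator Gamma factors enter through \<^const>\<open>rGamma\<close>, the reciprocal of the Gamma
  function extended by 0 to the nonpositive integers. The sum is meaningful under the convergence
  condition \<open>(\<Sum>(b, \<beta>)\<leftarrow>bs. \<beta>) - (\<Sum>(a, \<alpha>)\<leftarrow>as. \<alpha>) > - 1\<close>.
\<close>

definition fox_wright :: "(real \<times> real) list \<Rightarrow> (real \<times> real) list \<Rightarrow> real \<Rightarrow> real" where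
  "fox_wright as bs z =
     (\<Sum>j. (\<Prod>(a, \<alpha>)\<leftarrow>as. Gamma (a + \<alpha> * real j)) *
           (\<Prod>(b, \<beta>)\<leftarrow>bs. rGamma (b + \<beta> * real j)) * z ^ j / fact j)"

fun signed_stirling :: "nat \<Rightarrow> nat \<Rightarrow> int" where
  "signed_stirling 0 0 = 1"
| "signed_stirling 0 (Suc h) = 0"
| "signed_stirling (Suc k) 0 = 0"
| "signed_stirling (Suc k) (Suc h) = signed_stirling k h - int k * signed_stirling k (Suc h)"

text \<open>The library only has the unsigned numbers \<^const>\<open>stirling\<close>.\<close>

lemma signed_stirling_eq: "signed_stirling k h = (-1) ^ (k + h) * int (stirling k h)"
  by (induction k h rule: signed_stirling.induct) (simp_all add: algebra_simps)

subsection \<open>Correlated counting processes\<close>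

definition distribution_function_on :: "real \<Rightarrow> (real \<Rightarrow> real) \<Rightarrow> bool" where
  "distribution_function_on T F \<longleftrightarrow>
     mono_on {0..T} F \<and> (\<forall>t\<in>{0..<T}. continuous (at_right t) F) \<and> F 0 = 0 \<and> F T = 1"

definition pgf :: "'a measure \<Rightarrow> ('a \<Rightarrow> nat) \<Rightarrow> real \<Rightarrow> real" where
  "pgf \<Omega> N u = (\<integral>\<omega>. u ^ N \<omega> \<partial>\<Omega>)"

text \<open>
  For heavy-tailed \<open>N\<close> the power series need not converge beyond \<open>[-1, 1]\<close>, so generating functions
  are only prescribed there. In particular, \<open>mittag_leffler \<nu> 1 (- (ln ((1 - (1 - p) * u) / p) powr \<alpha>))\<close>
  is used for \<open>u \<le> 1\<close> only, where the logarithm is nonnegative. When \<open>q t = 1\<close> the factor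
  \<open>ln (1 / q t) powi (- h)\<close> is 0 in HOL, and the formula for \<open>k \<ge> 1\<close> gives 0, its limiting value.
\<close>

definition (in prob_space) covariance :: "('a \<Rightarrow> real) \<Rightarrow> ('a \<Rightarrow> real) \<Rightarrow> real" where
  "covariance X Y = expectation (\<lambda>\<omega>. (X \<omega> - expectation X) * (Y \<omega> - expectation Y))"

definition (in prob_space) correlation :: "('a \<Rightarrow> real) \<Rightarrow> ('a \<Rightarrow> real) \<Rightarrow> real" where
  "correlation X Y = covariance X Y / (sqrt (variance X) * sqrt (variance Y))"

definition counting_process ::
  "('a \<Rightarrow> nat) \<Rightarrow> (nat \<Rightarrow> 'a \<Rightarrow> real) \<Rightarrow> real \<Rightarrow> 'a \<Rightarrow> nat" where
  "counting_process M X t \<omega> = (\<Sum>n = 1..M \<omega>. indicator {0..t} (X n \<omega>))"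

text \<open>
  The variables \<open>X n\<close> are those with \<open>n \<ge> 1\<close>; \<open>X 0\<close> plays no role. Since \<open>F 0 = 0\<close> and \<open>F T = 1\<close>,
  prescribing their distribution function on \<open>[0, T]\<close> determines it on the whole line.
  The correlation coefficient is prescribed only where it is defined, that is, unless the \<open>X n\<close> are
  almost surely constant.
  Pairwise correlation does not determine the joint law of the \<open>X n\<close>. The dependence structure is
  specified by the probability generating function of the value of the process at each time.
\<close>

locale correlated_counting_process = prob_space \<Omega>
  for \<Omega> :: "'a measure" +
  fixes M :: "'a \<Rightarrow> nat" and X :: "nat \<Rightarrow> 'a \<Rightarrow> real"
    and F :: "real \<Rightarrow> real" and T \<rho> :: real
  assumes T_pos: "0 < T"
    and rho_range: "\<rho> \<in> {0..1}"
    and F_distribution: "distribution_function_on T F"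
    and M_measurable: "random_variable (count_space UNIV) M"
    and X_measurable: "\<And>n. 1 \<le> n \<Longrightarrow> random_variable borel (X n)"
    and X_cdf: "\<And>n t. 1 \<le> n \<Longrightarrow> t \<in> {0..T} \<Longrightarrow> cdf (distr \<Omega> borel (X n)) t = F t"
    and X_correlation: "\<And>m n. 1 \<le> m \<Longrightarrow> 1 \<le> n \<Longrightarrow> m \<noteq> n \<Longrightarrow>
          variance (X m) \<noteq> 0 \<Longrightarrow> variance (X n) \<noteq> 0 \<Longrightarrow> correlation (X m) (X n) = \<rho>"
    and M_X_indep: "indep_set
          (sets (vimage_algebra (space \<Omega>) M (count_space UNIV)))
          (sets (vimage_algebra (space \<Omega>) (\<lambda>\<omega>. \<lambda>n\<in>{1..}. X n \<omega>) (\<Pi>\<^sub>M n\<in>{1..}. borel)))"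
    and pgf_counting_process: "\<And>t u. t \<in> {0..T} \<Longrightarrow> u \<in> {-1..1} \<Longrightarrow>
          pgf \<Omega> (counting_process M X t) u =
            \<rho> * (1 - F t) + \<rho> * F t * pgf \<Omega> M u + (1 - \<rho>) * pgf \<Omega> M (1 - F t + F t * u)"

end

theory Submission
  imports Defs
begin

text \<open>
  On the open unit disc the generating function of a process is the power series of its probability
  mass function, so the mixture formula follows by comparing coefficients in the generating function
  of the process. For \<open>\<rho> = 0\<close> the generating function at \<open>t\<close> is
  \<open>u \<mapsto> \<phi> (ln (1 + A t - A t * u))\<close> with \<open>\<phi> x = mittag_leffler \<nu> 1 (- (x powr \<alpha>))\<close>, and
  its Taylor coefficients at 0 come from two iterated derivatives:
  \<open>x ^ h\<close> times the \<open>h\<close>-th derivative of \<open>\<phi>\<close> is the Fox-Wright series of the statement, and the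
  iterated chain rule for a composition with the logarithm has the signed Stirling numbers as
  coefficients.
\<close>

subsection \<open>Power series and iterated derivatives\<close>

lemma funpow_diffs: "(diffs ^^ n) c k = fact (n + k) / fact k * (c (n + k) :: real)"
proof (induction n arbitrary: k)
  case (Suc n)
  have "(diffs ^^ Suc n) c k = real (Suc k) * (diffs ^^ n) c (Suc k)"
    by (simp add: diffs_def)
  then show ?case
    by (simp add: Suc divide_simps)
qed auto

text \<open>Term-by-term differentiation shows that the n-fold \<open>diffs\<close> of
  \<open>c\<close> sums to \<open>D n\<close> on the whole disc, and at 0 only the constant term
  survives. The derivatives form an explicit family because closed forms for all orders are
  available in the application.\<close>

lemma sums_powser_coeff:
  fixes c :: "nat \<Rightarrow> real" and D :: "nat \<Rightarrow> real \<Rightarrow> real"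
  assumes "r > 0"
    and sums: "\<And>z. \<bar>z\<bar> < r \<Longrightarrow> (\<lambda>k. c k * z ^ k) sums D 0 z"
    and deriv: "\<And>n z. \<bar>z\<bar> < r \<Longrightarrow> (D n has_real_derivative D (Suc n) z) (at z)"
  shows "c n = D n 0 / fact n"
proof -
  have *: "(\<lambda>k. (diffs ^^ n) c k * z ^ k) sums D n z" if "\<bar>z\<bar> < r" for z
    using that
  proof (induction n arbitrary: z)
    case 0
    then show ?case using sums by simp
  next
    case (Suc n)
    have "(\<lambda>k. diffs ((diffs ^^ n) c) k * z ^ k) sums D (Suc n) z"
      using Suc deriv by (intro termdiffs_sums_strong[where f = "D n" and K = r]) auto
    then show ?case by simp
  qed
  have "(diffs ^^ n) c 0 = D n 0"
    using *[of 0] \<open>r > 0\<close> by simp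
  then show ?thesis
    by (simp add: funpow_diffs field_simps)
qed

text \<open>The difference series sums to 0 on the disc, and every derivative of the zero function
  is zero.\<close>

lemma powser_coeff_unique:
  fixes c d :: "nat \<Rightarrow> real"
  assumes "r > 0"
    and "\<And>z. \<bar>z\<bar> < r \<Longrightarrow> (\<lambda>k. c k * z ^ k) sums f z"
    and "\<And>z. \<bar>z\<bar> < r \<Longrightarrow> (\<lambda>k. d k * z ^ k) sums f z"
  shows "c = d"
proof
  fix n
  have "(\<lambda>k. (c k - d k) * z ^ k) sums 0" if "\<bar>z\<bar> < r" for z
    using sums_diff[OF assms(2,3)[OF that]] by (simp add: algebra_simps)
  then have "c n - d n = (\<lambda>_ _. 0 :: real) n (0 :: real) / fact n"
    using \<open>r > 0\<close> by (intro sums_powser_coeff[where r = r and D = "\<lambda>_ _. 0"]) auto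
  then show "c n = d n" by simp
qed

subsection \<open>Generating functions\<close>

text \<open>The expectation is split over the level sets of \<open>N\<close>. Interchanging sum and
  integral is justified by the geometric majorant, which converges because u lies in the open
  disc.\<close>

lemma (in prob_space) pgf_sums:
  assumes N: "random_variable (count_space UNIV) N" and u: "\<bar>u\<bar> < 1"
  shows "(\<lambda>k. prob {\<omega> \<in> space M. N \<omega> = k} * u ^ k) sums pgf M N u"
proof -
  define f where "f k \<omega> = u ^ k * indicator {\<omega> \<in> space M. N \<omega> = k} \<omega>" for k \<omega>
  have sets: "{\<omega> \<in> space M. N \<omega> = k} \<in> events" for k
    using measurable_sets[OF N, of "{k}"] by (simp add: vimage_def Int_def conj_commute)
  have inter: "{\<omega> \<in> space M. N \<omega> = k} \<inter> space M = {\<omega> \<in> space M. N \<omega> = k}" for k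
    by auto
  have int: "integrable M (f k)" for k
    unfolding f_def using sets by (intro integrable_mult_right integrable_real_indicator) (simp_all add: less_top[symmetric])
  \<comment> \<open>At a fixed point the series has a single nonzero term, the one with index
    \<open>N \<omega>\<close>.\<close>
  have fval: "f k \<omega> = (if k = N \<omega> then u ^ k else 0)" if "\<omega> \<in> space M" for k \<omega>
    using that by (auto simp: f_def)
  have sumsf: "(\<lambda>k. f k \<omega>) sums (u ^ N \<omega>)" if "\<omega> \<in> space M" for \<omega>
    using sums_single[of "N \<omega>" "\<lambda>k. u ^ k"] by (simp add: fval[OF that])
  have "(\<lambda>k. norm (f k \<omega>)) sums (\<bar>u\<bar> ^ N \<omega>)" if "\<omega> \<in> space M" for \<omega>
    using sums_single[of "N \<omega>" "\<lambda>k. \<bar>u\<bar> ^ k"]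
    by (simp add: fval[OF that] if_distrib power_abs cong: if_cong)
  then have sm1: "AE \<omega> in M. summable (\<lambda>k. norm (f k \<omega>))"
    by (auto simp: sums_iff)
  have nf: "(\<integral>\<omega>. norm (f k \<omega>) \<partial>M) = \<bar>u\<bar> ^ k * prob {\<omega> \<in> space M. N \<omega> = k}" for k
    by (simp add: f_def abs_mult power_abs inter)
  have sm2: "summable (\<lambda>k. \<integral>\<omega>. norm (f k \<omega>) \<partial>M)"
    unfolding nf
  proof (rule summable_comparison_test')
    show "summable (\<lambda>k. \<bar>u\<bar> ^ k)"
      using u by (simp add: summable_geometric)
    show "norm (\<bar>u\<bar> ^ k * prob {\<omega> \<in> space M. N \<omega> = k}) \<le> \<bar>u\<bar> ^ k" for k
      by (simp add: abs_mult mult_left_le)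
  qed
  have "(\<lambda>k. \<integral>\<omega>. f k \<omega> \<partial>M) sums (\<integral>\<omega>. (\<Sum>k. f k \<omega>) \<partial>M)"
    by (rule sums_integral[OF int sm1 sm2])
  moreover have "(\<integral>\<omega>. (\<Sum>k. f k \<omega>) \<partial>M) = pgf M N u"
    unfolding pgf_def using sumsf by (intro Bochner_Integration.integral_cong) (auto simp: sums_iff)
  moreover have "(\<integral>\<omega>. f k \<omega> \<partial>M) = prob {\<omega> \<in> space M. N \<omega> = k} * u ^ k" for k
    by (simp add: f_def inter)
  ultimately show ?thesis by simp
qed

text \<open>Keeps the inner argument of the generating function of \<open>M\<close> inside the
  interval on which that function is prescribed.\<close>

lemma convex_comb_one_range:
  fixes f u :: real
  assumes "f \<in> {0..1}" "\<bar>u\<bar> < 1"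
  shows "1 - f + f * u \<in> {-1..1}"
proof -
  have "f * (1 - u) \<le> 1 * (1 - u)"
    using assms by (intro mult_right_mono) auto
  moreover have "0 \<le> f * (1 - u)"
    using assms by simp
  ultimately show ?thesis
    using assms by (auto simp: algebra_simps)
qed

context correlated_counting_process
begin

lemma F_range: "t \<in> {0..T} \<Longrightarrow> F t \<in> {0..1}"
  using F_distribution T_pos mono_onD[of "{0..T}" F 0 t] mono_onD[of "{0..T}" F t T]
  by (auto simp: distribution_function_on_def)

lemma measurable_counting_process:
  "counting_process M X t \<in> measurable \<Omega> (count_space UNIV)"
proof -
  have *: "(\<lambda>\<omega>. \<Sum>n = 1..m. indicator {0..t} (X n \<omega>) :: nat) \<in> measurable \<Omega> (count_space UNIV)"
    for m :: nat
  proof (rule measurable_sum_nat)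
    fix n assume "n \<in> {1..m}"
    then have [measurable]: "X n \<in> borel_measurable \<Omega>"
      using X_measurable by simp
    show "(\<lambda>\<omega>. indicator {0..t} (X n \<omega>) :: nat) \<in> measurable \<Omega> (count_space UNIV)"
      unfolding indicator_def by measurable
  qed
  show ?thesis
    unfolding counting_process_def[abs_def]
    \<comment> \<open>The random upper limit takes countably many values, so measurability for each
      fixed upper limit is enough.\<close>
    by (rule measurable_compose_countable[OF * M_measurable])
qed

text \<open>The later arguments use the law of the process only through this expansion.\<close>

lemma pmf_counting_process_sums:
  assumes "t \<in> {0..T}" "\<bar>u\<bar> < 1"
  shows "(\<lambda>k. \<P>(\<omega> in \<Omega>. counting_process M X t \<omega> = k) * u ^ k) sums
    (\<rho> * (1 - F t) + \<rho> * F t * pgf \<Omega> M u + (1 - \<rho>) * pgf \<Omega> M (1 - F t + F t * u))"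
proof -
  have "u \<in> {-1..1}"
    using assms by auto
  from pgf_counting_process[OF assms(1) this] show ?thesis
    using pgf_sums[OF measurable_counting_process assms(2), of t] by simp
qed

end

subsection \<open>Mittag-Leffler and Fox-Wright series\<close>

text \<open>Euler's integral is cut down to t at least R, where t powr x is at least R powr x. Since
  R is free, Gamma outgrows every geometric sequence.\<close>

lemma Gamma_lower_bound:
  fixes x R :: real
  assumes "x \<ge> 0" "R > 0"
  shows "R powr x * exp (- R) \<le> Gamma (x + 1)"
proof -
  have "((\<lambda>t. R powr x * exp (- 1 * t)) has_integral R powr x * (exp (- 1 * R) / 1)) {R..}"
    by (intro has_integral_mult_right has_integral_exp_minus_to_infinity) simp
  then have 1: "((\<lambda>t. if t \<in> {R..} then R powr x * exp (- 1 * t) else 0) has_integral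
      R powr x * exp (- R)) {0..}"
    using assms by (subst has_integral_restrict) auto
  have 2: "((\<lambda>t. t powr x / exp t) has_integral Gamma (x + 1)) {0..}"
    using Gamma_integral_real[of "x + 1"] assms by simp
  show ?thesis
    using assms by (intro has_integral_le[OF 1 2]) (auto simp: exp_minus field_simps intro: powr_mono2)
qed

lemma summable_rGamma_powser:
  fixes \<nu> z :: real
  assumes "\<nu> > 0"
  shows "summable (\<lambda>j. rGamma (1 + \<nu> * real j) * z ^ j)"
proof (rule summable_comparison_test')
  \<comment> \<open>This R makes \<open>R powr (\<nu> * real j)\<close> equal to the j-th power of
    twice \<open>\<bar>z\<bar> + 1\<close>, so the majorant is geometric with ratio below
    1/2.\<close>
  define R where "R = (2 * (\<bar>z\<bar> + 1)) powr (1 / \<nu>)"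
  have "R > 0"
    by (simp add: R_def)
  show "summable (\<lambda>j. exp R * (\<bar>z\<bar> / (2 * (\<bar>z\<bar> + 1))) ^ j)"
    by (intro summable_mult summable_geometric) (simp add: field_simps)
  fix j :: nat
  have "R powr (\<nu> * real j) = (2 * (\<bar>z\<bar> + 1)) ^ j"
    using assms by (simp add: R_def powr_powr powr_realpow)
  then have *: "(2 * (\<bar>z\<bar> + 1)) ^ j * exp (- R) \<le> Gamma (\<nu> * real j + 1)"
    using Gamma_lower_bound[of "\<nu> * real j" R] assms \<open>R > 0\<close> by simp
  have pos: "0 < (2 * (\<bar>z\<bar> + 1)) ^ j * exp (- R)"
    by simp
  have Gamma_pos: "Gamma (\<nu> * real j + 1) > 0"
    using order_less_le_trans[OF pos *] .
  have "norm (rGamma (1 + \<nu> * real j) * z ^ j) = \<bar>z\<bar> ^ j / Gamma (\<nu> * real j + 1)"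
    using Gamma_pos by (simp add: rGamma_inverse_Gamma abs_mult power_abs add.commute divide_inverse)
  also have "\<dots> \<le> \<bar>z\<bar> ^ j / ((2 * (\<bar>z\<bar> + 1)) ^ j * exp (- R))"
    using pos * Gamma_pos by (intro divide_left_mono mult_pos_pos) auto
  also have "\<dots> = exp R * (\<bar>z\<bar> / (2 * (\<bar>z\<bar> + 1))) ^ j"
    by (simp add: exp_minus power_divide field_simps)
  finally show "norm (rGamma (1 + \<nu> * real j) * z ^ j) \<le> exp R * (\<bar>z\<bar> / (2 * (\<bar>z\<bar> + 1))) ^ j" .
qed

text \<open>The Euler operator z d/dz multiplies the n-th coefficient by n.\<close>

lemma sums_of_nat_mult_powser:
  fixes c :: "nat \<Rightarrow> real"
  assumes "\<And>z. summable (\<lambda>n. c n * z ^ n)"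
  shows "(\<lambda>n. real n * c n * z ^ n) sums (z * (\<Sum>n. diffs c n * z ^ n))"
proof -
  have "(\<lambda>n. real n * c n * z ^ (n - Suc 0)) sums (\<Sum>n. diffs c n * z ^ n)"
    by (intro diffs_equiv termdiff_converges_all assms)
  then have "(\<lambda>n. z * (real n * c n * z ^ (n - Suc 0))) sums (z * (\<Sum>n. diffs c n * z ^ n))"
    by (rule sums_mult)
  moreover have "z * (real n * c n * z ^ (n - Suc 0)) = real n * c n * z ^ n" for n
    by (cases n) auto
  ultimately show ?thesis by simp
qed

text \<open>The coefficient of z^j in the Fox-Wright series of the theorem, after
  \<open>Gamma (1 + j)\<close> from the pair (1, 1) has cancelled against j!. For nonnegative
  \<alpha>, the first two factors form the falling factorial of \<alpha> j of order h.\<close>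

definition fw_coeff :: "real \<Rightarrow> real \<Rightarrow> nat \<Rightarrow> nat \<Rightarrow> real" where
  "fw_coeff \<alpha> \<nu> h j =
     Gamma (1 + \<alpha> * real j) * rGamma (1 - real h + \<alpha> * real j) * rGamma (1 + \<nu> * real j)"

lemma fw_coeff_0:
  assumes "\<alpha> \<ge> 0"
  shows "fw_coeff \<alpha> \<nu> 0 j = rGamma (1 + \<nu> * real j)"
proof -
  have "0 < 1 + \<alpha> * real j"
    using assms by (simp add: add_pos_nonneg)
  then have "Gamma (1 + \<alpha> * real j) > 0"
    by (rule Gamma_real_pos)
  then show ?thesis
    by (simp add: fw_coeff_def rGamma_inverse_Gamma)
qed

text \<open>This is the functional equation of the reciprocal Gamma function at \<alpha> j - h. It
  also holds at the poles of Gamma, so no case distinction arises when \<alpha> j is an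
  integer.\<close>

lemma fw_coeff_Suc: "fw_coeff \<alpha> \<nu> (Suc h) j = (\<alpha> * real j - real h) * fw_coeff \<alpha> \<nu> h j"
  using rGamma_plus1[of "\<alpha> * real j - real h"]
  by (simp add: fw_coeff_def algebra_simps)

definition fw :: "real \<Rightarrow> real \<Rightarrow> nat \<Rightarrow> real \<Rightarrow> real" where
  "fw \<alpha> \<nu> h z = fox_wright [(1, \<alpha>), (1, 1)] [(1 - real h, \<alpha>), (1, \<nu>)] z"

lemma fw_powser: "fw \<alpha> \<nu> h z = (\<Sum>j. fw_coeff \<alpha> \<nu> h j * z ^ j)"
proof -
  have "Gamma (1 + real j) = fact j" for j
    by (metis Gamma_fact)
  then show ?thesis
    by (simp add: fw_def fox_wright_def fw_coeff_def mult_ac)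
qed

lemma fw_0: "\<alpha> \<ge> 0 \<Longrightarrow> fw \<alpha> \<nu> 0 z = mittag_leffler \<nu> 1 z"
  by (simp add: fw_powser fw_coeff_0 mittag_leffler_def rGamma_inverse_Gamma field_simps)

lemma summable_fw_coeff:
  assumes "\<alpha> \<ge> 0" "\<nu> > 0"
  shows "summable (\<lambda>j. fw_coeff \<alpha> \<nu> h j * z ^ j)"
proof (induction h arbitrary: z)
  case 0
  then show ?case
    using assms by (simp add: fw_coeff_0 summable_rGamma_powser)
next
  case (Suc h)
  \<comment> \<open>Raising h applies the Euler operator and a scalar multiple, both of which
    preserve convergence everywhere.\<close>
  have "summable (\<lambda>j. \<alpha> * (real j * fw_coeff \<alpha> \<nu> h j * z ^ j) - real h * (fw_coeff \<alpha> \<nu> h j * z ^ j))"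
    by (intro summable_diff summable_mult Suc sums_summable[OF sums_of_nat_mult_powser])
  then show ?case
    by (simp add: fw_coeff_Suc algebra_simps)
qed

text \<open>The coefficient recursion says that the series of index h + 1 arises from that of index
  h by the operator \<alpha> z d/dz - h.\<close>

lemma fw_has_derivative:
  assumes "\<alpha> \<ge> 0" "\<nu> > 0"
  obtains D where "(fw \<alpha> \<nu> h has_real_derivative D) (at z)"
    "fw \<alpha> \<nu> (Suc h) z = \<alpha> * (z * D) - real h * fw \<alpha> \<nu> h z"
proof
  let ?c = "fw_coeff \<alpha> \<nu> h"
  note sm = summable_fw_coeff[OF assms, of h]
  show "(fw \<alpha> \<nu> h has_real_derivative (\<Sum>j. diffs ?c j * z ^ j)) (at z)"
    unfolding fw_powser[abs_def] by (rule termdiffs_strong_converges_everywhere[OF sm])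
  have "(\<lambda>j. \<alpha> * (real j * ?c j * z ^ j) - real h * (?c j * z ^ j)) sums
      (\<alpha> * (z * (\<Sum>j. diffs ?c j * z ^ j)) - real h * fw \<alpha> \<nu> h z)"
    unfolding fw_powser
    by (intro sums_diff sums_mult summable_sums sm sums_of_nat_mult_powser)
  then have "(\<lambda>j. fw_coeff \<alpha> \<nu> (Suc h) j * z ^ j) sums
      (\<alpha> * (z * (\<Sum>j. diffs ?c j * z ^ j)) - real h * fw \<alpha> \<nu> h z)"
    by (simp add: fw_coeff_Suc algebra_simps)
  then show "fw \<alpha> \<nu> (Suc h) z = \<alpha> * (z * (\<Sum>j. diffs ?c j * z ^ j)) - real h * fw \<alpha> \<nu> h z"
    unfolding fw_powser by (simp add: sums_iff)
qed

text \<open>Under z = - (x powr \<alpha>) the operator \<alpha> z d/dz becomes x d/dx, and (x d/dx -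
  h) f equals x^(h+1) times the derivative of f / x^h. Iteration from h = 0 yields all derivatives
  of the Mittag-Leffler function at - (x powr \<alpha>) as a function of x.\<close>

lemma fw_powr_has_derivative:
  assumes "\<alpha> \<ge> 0" "\<nu> > 0" "x > 0"
  shows "((\<lambda>x. fw \<alpha> \<nu> h (- (x powr \<alpha>)) / x ^ h) has_real_derivative
    fw \<alpha> \<nu> (Suc h) (- (x powr \<alpha>)) / x ^ Suc h) (at x)"
proof -
  obtain D where D: "(fw \<alpha> \<nu> h has_real_derivative D) (at (- (x powr \<alpha>)))"
    and fwS: "fw \<alpha> \<nu> (Suc h) (- (x powr \<alpha>)) =
      \<alpha> * (- (x powr \<alpha>) * D) - real h * fw \<alpha> \<nu> h (- (x powr \<alpha>))"
    using fw_has_derivative[OF assms(1,2)] .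
  have "((\<lambda>x. - (x powr \<alpha>)) has_real_derivative - (\<alpha> * x powr (\<alpha> - 1))) (at x)"
    using assms by (auto intro!: derivative_eq_intros)
  from DERIV_chain2[OF D this]
  have "((\<lambda>x. fw \<alpha> \<nu> h (- (x powr \<alpha>))) has_real_derivative D * - (\<alpha> * x powr (\<alpha> - 1))) (at x)" .
  from DERIV_divide[OF this DERIV_pow[of h x]] assms
  have deriv: "((\<lambda>x. fw \<alpha> \<nu> h (- (x powr \<alpha>)) / x ^ h) has_real_derivative
      (D * - (\<alpha> * x powr (\<alpha> - 1)) * x ^ h - fw \<alpha> \<nu> h (- (x powr \<alpha>)) * (real h * x ^ (h - Suc 0)))
        / (x ^ h * x ^ h)) (at x)"
    by simp
  have powr: "x powr (\<alpha> - 1) = x powr \<alpha> / x"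
    using assms by (simp add: powr_diff)
  \<comment> \<open>The exponent is truncated at h = 0, where the factor \<open>real h\<close> makes
    both sides 0.\<close>
  have pow: "real h * x ^ (h - Suc 0) = real h * x ^ h / x"
    using assms by (cases h) auto
  show ?thesis
  proof (rule DERIV_cong[OF deriv])
    \<comment> \<open>Powers and function values are replaced by variables, which leaves a rational
      identity.\<close>
    have "(D * - (\<alpha> * (P / x)) * H - f * (c * H / x)) / (H * H) = (\<alpha> * (- P * D) - c * f) / (x * H)"
      if "H \<noteq> 0" for P H f c :: real
      using assms(3) that by (simp add: field_simps)
    then show "(D * - (\<alpha> * x powr (\<alpha> - 1)) * x ^ h -
        fw \<alpha> \<nu> h (- (x powr \<alpha>)) * (real h * x ^ (h - Suc 0))) / (x ^ h * x ^ h) =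
      fw \<alpha> \<nu> (Suc h) (- (x powr \<alpha>)) / x ^ Suc h"
      unfolding powr pow fwS power_Suc using assms by simp
  qed
qed

subsection \<open>Iterated derivatives of a composition with the logarithm\<close>

lemma signed_stirling_gt: "k < h \<Longrightarrow> signed_stirling k h = 0"
  by (induction k h rule: signed_stirling.induct) auto

text \<open>A discrete summation by parts: an index shift moves the Stirling recurrence from the
  coefficients onto \<open>f\<close>.\<close>

lemma sum_signed_stirling_Suc:
  fixes f :: "nat \<Rightarrow> real"
  shows "(\<Sum>h\<le>Suc k. of_int (signed_stirling (Suc k) h) * f h) =
    (\<Sum>h\<le>k. of_int (signed_stirling k h) * (f (Suc h) - real k * f h))"
proof -
  have "(\<Sum>h\<le>k. of_int (signed_stirling k (Suc h)) * f (Suc h)) +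
      of_int (signed_stirling k 0) * f 0 = (\<Sum>h\<le>Suc k. of_int (signed_stirling k h) * f h)"
    by (subst sum.atMost_Suc_shift) simp
  also have "\<dots> = (\<Sum>h\<le>k. of_int (signed_stirling k h) * f h)"
    by (simp add: signed_stirling_gt)
  \<comment> \<open>The term at index 0 disappears after multiplication by k: either k = 0 or the
    Stirling number at (k, 0) is 0.\<close>
  finally have *: "real k * (\<Sum>h\<le>k. of_int (signed_stirling k (Suc h)) * f (Suc h)) =
      real k * (\<Sum>h\<le>k. of_int (signed_stirling k h) * f h)"
    by (cases k) auto
  have "(\<Sum>h\<le>Suc k. of_int (signed_stirling (Suc k) h) * f h) =
      (\<Sum>h\<le>k. of_int (signed_stirling (Suc k) (Suc h)) * f (Suc h))"
    by (subst sum.atMost_Suc_shift) simp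
  also have "\<dots> = (\<Sum>h\<le>k. of_int (signed_stirling k h) * f (Suc h)) -
      real k * (\<Sum>h\<le>k. of_int (signed_stirling k (Suc h)) * f (Suc h))"
    by (simp add: algebra_simps sum_subtractf sum_distrib_left)
  also have "\<dots> = (\<Sum>h\<le>k. of_int (signed_stirling k h) * (f (Suc h) - real k * f h))"
    unfolding * by (simp add: algebra_simps sum_subtractf sum_distrib_left)
  finally show ?thesis .
qed

text \<open>With B = b - a u, differentiating Q h (ln B) raises h and contributes the factor - a /
  B, while differentiating the prefactor contributes - k times that same factor. The resulting
  combination of Q (h + 1) and - k Q h is what \<open>sum_signed_stirling_Suc\<close> turns into the
  numbers of row k + 1.\<close>

lemma iterated_derivative_ln_comp:
  fixes Q :: "nat \<Rightarrow> real \<Rightarrow> real" and a b u :: real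
  assumes Q: "\<And>h. (Q h has_real_derivative Q (Suc h) (ln (b - a * u))) (at (ln (b - a * u)))"
    and pos: "b - a * u > 0"
  defines "D \<equiv> \<lambda>k u. (- a) ^ k / (b - a * u) ^ k *
      (\<Sum>h\<le>k. of_int (signed_stirling k h) * Q h (ln (b - a * u)))"
  shows "(D k has_real_derivative D (Suc k) u) (at u)"
proof -
  let ?B = "b - a * u"
  let ?S = "\<Sum>h\<le>k. of_int (signed_stirling k h) * Q h (ln ?B)"
  let ?S' = "\<Sum>h\<le>k. of_int (signed_stirling k h) * Q (Suc h) (ln ?B)"
  have ln': "((\<lambda>u. ln (b - a * u)) has_real_derivative (- a / ?B)) (at u)"
    using pos by (auto intro!: derivative_eq_intros)
  have "((\<lambda>u. of_int (signed_stirling k h) * Q h (ln (b - a * u))) has_real_derivative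
      of_int (signed_stirling k h) * (Q (Suc h) (ln ?B) * (- a / ?B))) (at u)" for h
    by (intro DERIV_cmult DERIV_chain2[OF Q ln'])
  then have "((\<lambda>u. \<Sum>h\<le>k. of_int (signed_stirling k h) * Q h (ln (b - a * u))) has_real_derivative
      (\<Sum>h\<le>k. of_int (signed_stirling k h) * (Q (Suc h) (ln ?B) * (- a / ?B)))) (at u)"
    by (intro DERIV_sum)
  then have S: "((\<lambda>u. \<Sum>h\<le>k. of_int (signed_stirling k h) * Q h (ln (b - a * u)))
      has_real_derivative ?S' * (- a / ?B)) (at u)"
    by (simp add: sum_distrib_right sum_distrib_left mult_ac)
  have deriv: "((\<lambda>u. (- a) ^ k / (b - a * u) ^ k) has_real_derivative
      (- ((- a) ^ k * (real k * ?B ^ (k - Suc 0) * (- a)))) / (?B ^ k * ?B ^ k)) (at u)"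
    using pos by (auto intro!: derivative_eq_intros)
  have eq: "(- ((- a) ^ k * (real k * ?B ^ (k - Suc 0) * (- a)))) / (?B ^ k * ?B ^ k) =
      - real k * ((- a) ^ Suc k / ?B ^ Suc k)"
    using pos by (cases k) (simp_all add: divide_simps, simp add: algebra_simps)
  have "((\<lambda>u. (- a) ^ k / (b - a * u) ^ k) has_real_derivative
      - real k * ((- a) ^ Suc k / ?B ^ Suc k)) (at u)"
    using deriv unfolding eq .
  from DERIV_mult[OF this S]
  have "(D k has_real_derivative (- a) ^ Suc k / ?B ^ Suc k * (?S' - real k * ?S)) (at u)"
    unfolding D_def
  proof (rule DERIV_cong)
    have "P * c = P' \<Longrightarrow> - real k * P' * S + S' * c * P = P' * (S' - real k * S)"
      for P P' S S' c :: real
      by (auto simp: algebra_simps)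
    then show "- real k * ((- a) ^ Suc k / ?B ^ Suc k) * ?S + ?S' * (- a / ?B) * ((- a) ^ k / ?B ^ k) =
        (- a) ^ Suc k / ?B ^ Suc k * (?S' - real k * ?S)"
      by this (simp add: mult_ac)
  qed
  also have "?S' - real k * ?S =
      (\<Sum>h\<le>Suc k. of_int (signed_stirling (Suc k) h) * Q h (ln ?B))"
    unfolding sum_signed_stirling_Suc by (simp add: algebra_simps sum_subtractf sum_distrib_left)
  finally show ?thesis
    unfolding D_def .
qed

subsection \<open>Probability mass functions\<close>

text \<open>The two processes may live on different probability spaces; only the generating
  functions of \<open>M\<close> and \<open>M\<^sub>0\<close> are matched. At time T the uncorrelated
  process has the generating function of \<open>M\<^sub>0\<close>, because F T = 1, so its
  probabilities at T replace those of the total count.\<close>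

lemma mixture_pmf:
  assumes "correlated_counting_process \<Omega> M X F T \<rho>"
    and "correlated_counting_process \<Omega>\<^sub>0 M\<^sub>0 X\<^sub>0 F T 0"
    and pgf_eq: "\<And>u. u \<in> {-1..1} \<Longrightarrow> pgf \<Omega> M u = pgf \<Omega>\<^sub>0 M\<^sub>0 u"
    and t: "t \<in> {0..T}"
  shows "\<P>(\<omega> in \<Omega>. counting_process M X t \<omega> = k) =
    (1 - \<rho>) * \<P>(\<omega> in \<Omega>\<^sub>0. counting_process M\<^sub>0 X\<^sub>0 t \<omega> = k) +
    \<rho> * ((1 - F t) * (if k = 0 then 1 else 0) +
      F t * \<P>(\<omega> in \<Omega>\<^sub>0. counting_process M\<^sub>0 X\<^sub>0 T \<omega> = k))"
proof -
  interpret P: correlated_counting_process \<Omega> M X F T \<rho> by fact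
  interpret P0: correlated_counting_process \<Omega>\<^sub>0 M\<^sub>0 X\<^sub>0 F T 0 by fact
  let ?p0 = "\<lambda>t k. \<P>(\<omega> in \<Omega>\<^sub>0. counting_process M\<^sub>0 X\<^sub>0 t \<omega> = k)"
  let ?G = "\<lambda>u. \<rho> * (1 - F t) + \<rho> * F t * pgf \<Omega> M u + (1 - \<rho>) * pgf \<Omega> M (1 - F t + F t * u)"
  have T: "T \<in> {0..T}" and FT: "F T = 1"
    using P.T_pos P.F_distribution by (auto simp: distribution_function_on_def)
  have "(\<lambda>k. \<P>(\<omega> in \<Omega>. counting_process M X t \<omega> = k)) =
    (\<lambda>k. (1 - \<rho>) * ?p0 t k + \<rho> * ((1 - F t) * (if k = 0 then 1 else 0) + F t * ?p0 T k))"
  proof (rule powser_coeff_unique[where r = 1 and f = ?G])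
    fix u :: real assume u: "\<bar>u\<bar> < 1"
    show "(\<lambda>k. \<P>(\<omega> in \<Omega>. counting_process M X t \<omega> = k) * u ^ k) sums ?G u"
      by (rule P.pmf_counting_process_sums[OF t u])
    have "u \<in> {-1..1}"
      using u by auto
    then have eqs: "pgf \<Omega> M (1 - F t + F t * u) = pgf \<Omega>\<^sub>0 M\<^sub>0 (1 - F t + F t * u)"
      "pgf \<Omega> M u = pgf \<Omega>\<^sub>0 M\<^sub>0 u"
      using pgf_eq convex_comb_one_range[OF P.F_range[OF t] u] by blast+
    have "(\<lambda>k. ?p0 t k * u ^ k) sums pgf \<Omega>\<^sub>0 M\<^sub>0 (1 - F t + F t * u)"
      using P0.pmf_counting_process_sums[OF t u] by simp
    moreover have "(\<lambda>k. ?p0 T k * u ^ k) sums pgf \<Omega>\<^sub>0 M\<^sub>0 u"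
      using P0.pmf_counting_process_sums[OF T u] FT by simp
    moreover have "(\<lambda>k. (if k = 0 then 1 else 0) * u ^ k) sums 1"
      using sums_single[of 0 "\<lambda>k. u ^ k"] by (simp add: if_distrib[where f = "\<lambda>x. x * _"] cong: if_cong)
    ultimately have "(\<lambda>k. (1 - \<rho>) * (?p0 t k * u ^ k) +
        \<rho> * ((1 - F t) * ((if k = 0 then 1 else 0) * u ^ k) + F t * (?p0 T k * u ^ k)))
      sums ((1 - \<rho>) * pgf \<Omega>\<^sub>0 M\<^sub>0 (1 - F t + F t * u) +
        \<rho> * ((1 - F t) * 1 + F t * pgf \<Omega>\<^sub>0 M\<^sub>0 u))"
      by (intro sums_add sums_mult)
    then show "(\<lambda>k. ((1 - \<rho>) * ?p0 t k +
        \<rho> * ((1 - F t) * (if k = 0 then 1 else 0) + F t * ?p0 T k)) * u ^ k) sums ?G u"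
      unfolding eqs by (simp add: algebra_simps)
  qed simp
  then show ?thesis
    by (rule fun_cong)
qed

text \<open>Here a stands for the A_t of the theorem. Letting h start at 0 covers k = 0, where only
  the Mittag-Leffler term remains, together with k at least 1.\<close>

lemma uncorrelated_pmf:
  fixes p \<alpha> \<nu> a :: real
  assumes "correlated_counting_process \<Omega> M X F T 0"
    and p: "p \<in> {0<..<1}" and alpha: "\<alpha> > 0" and nu: "\<nu> > 0"
    and pgf_M: "\<And>u. u \<in> {-1..1} \<Longrightarrow>
      pgf \<Omega> M u = mittag_leffler \<nu> 1 (- (ln ((1 - (1 - p) * u) / p) powr \<alpha>))"
    and t: "t \<in> {0..T}"
    and a: "a = (1 / p - 1) * F t"
  shows "\<P>(\<omega> in \<Omega>. counting_process M X t \<omega> = k) =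
    1 / fact k * ((- a) ^ k / (1 + a) ^ k) *
      (\<Sum>h\<le>k. of_int (signed_stirling k h) * (fw \<alpha> \<nu> h (- (ln (1 + a) powr \<alpha>)) / ln (1 + a) ^ h))"
proof -
  interpret correlated_counting_process \<Omega> M X F T 0 by fact
  let ?p = "\<lambda>k. \<P>(\<omega> in \<Omega>. counting_process M X t \<omega> = k)"
  let ?g = "\<lambda>u. mittag_leffler \<nu> 1 (- (ln (1 + a - a * u) powr \<alpha>))"
  have "a \<ge> 0"
    using p F_range[OF t] by (auto simp: a)
  have pgf: "(\<lambda>k. ?p k * u ^ k) sums ?g u" if u: "\<bar>u\<bar> < 1" for u
  proof -
    \<comment> \<open>The value of a is chosen so that the argument of the logarithm becomes 1 + a -
      a u.\<close>
    have "(1 - (1 - p) * (1 - F t + F t * u)) / p = 1 + a - a * u"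
      using p by (simp add: a field_simps)
    with pgf_M[OF convex_comb_one_range[OF F_range[OF t] u]] pmf_counting_process_sums[OF t u] show ?thesis
      by simp
  qed
  show ?thesis
  proof (cases "a = 0")
    case True
    \<comment> \<open>Here \<open>ln (1 + a) = 0\<close> and the quotients by its powers are junk, but \<open>(- a) ^ k\<close> vanishes for
      \<open>k > 0\<close>.\<close>
    have "?p = (\<lambda>k. if k = 0 then ?g 0 else 0)"
    proof (rule powser_coeff_unique[where r = 1 and f = ?g])
      fix u :: real assume "\<bar>u\<bar> < 1"
      then show "(\<lambda>k. ?p k * u ^ k) sums ?g u" by (rule pgf)
      show "(\<lambda>k. (if k = 0 then ?g 0 else 0) * u ^ k) sums ?g u"
        using sums_single[of 0 "\<lambda>k. ?g 0 * u ^ k"]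
        by (simp add: True if_distrib[where f = "\<lambda>x. x * _"] cong: if_cong)
    qed simp
    then show ?thesis
      using alpha True by (cases k) (auto simp: fw_0 fun_eq_iff)
  next
    case False
    with \<open>a \<ge> 0\<close> have "a > 0" by simp
    \<comment> \<open>\<open>Q 0\<close> is the Mittag-Leffler function at - (x powr \<alpha>), and
      \<open>Q h\<close> is its h-th derivative in x on the positive half-line.\<close>
    define Q where "Q h x = fw \<alpha> \<nu> h (- (x powr \<alpha>)) / x ^ h" for h x
    have Q: "(Q h has_real_derivative Q (Suc h) x) (at x)" if "x > 0" for h x
      unfolding Q_def[abs_def] using alpha nu that by (intro fw_powr_has_derivative) auto
    \<comment> \<open>The k-th derivative of the generating function on the unit disc; at u = 0 it
      gives the claimed formula up to k!.\<close>
    define D where "D k u = (- a) ^ k / (1 + a - a * u) ^ k *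
      (\<Sum>h\<le>k. of_int (signed_stirling k h) * Q h (ln (1 + a - a * u)))" for k u
    have "?p k = D k 0 / fact k"
    proof (rule sums_powser_coeff[where r = 1])
      fix u :: real assume u: "\<bar>u\<bar> < 1"
      show "(\<lambda>k. ?p k * u ^ k) sums D 0 u"
        using pgf[OF u] alpha by (simp add: D_def Q_def fw_0)
      \<comment> \<open>For a > 0 the logarithm is strictly positive throughout the open disc, so
        \<open>Q\<close> is differentiable at every point where it is evaluated.\<close>
      have "a * u < a * 1"
        using \<open>a > 0\<close> u by (intro mult_strict_left_mono) auto
      then have pos: "1 + a - a * u > 1" by simp
      show "(D n has_real_derivative D (Suc n) u) (at u)" for n
        unfolding D_def using pos by (intro iterated_derivative_ln_comp Q) auto
    qed simp
    then show ?thesis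
      by (simp add: D_def Q_def)
  qed
qed

theorem proposition3p2:
  fixes T p \<alpha> \<nu> \<rho> :: real
    and q F A :: "real \<Rightarrow> real"
    and \<Omega> :: "'a measure" and M :: "'a \<Rightarrow> nat" and X :: "nat \<Rightarrow> 'a \<Rightarrow> real"
    and \<Omega>\<^sub>0 :: "'b measure" and M\<^sub>0 :: "'b \<Rightarrow> nat" and X\<^sub>0 :: "nat \<Rightarrow> 'b \<Rightarrow> real"
  assumes T: "0 < T"
    and p: "p \<in> {0<..<1}"
    and alpha: "\<alpha> \<in> {0<..1}"
    and nu: "\<nu> \<in> {0<..1}"
    and rho: "\<rho> \<in> {0..1}"
    and q_range: "q \<in> {0..T} \<rightarrow> {0<..1}"
    and q_decreasing: "antimono_on {0..T} q"
    and q_T: "q T = p"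
    and F: "\<And>t. t \<in> {0..T} \<Longrightarrow> F t = (1 / q t - 1) / (1 / p - 1)"
    and F_distribution: "distribution_function_on T F"
    and A: "\<And>t. t \<in> {0..T} \<Longrightarrow> A t = 1 / q t - 1"
    and process: "correlated_counting_process \<Omega> M X F T \<rho>"
    and pgf_M: "\<And>u. u \<in> {-1..1} \<Longrightarrow>
          pgf \<Omega> M u = mittag_leffler \<nu> 1 (- (ln ((1 - (1 - p) * u) / p) powr \<alpha>))"
    and process\<^sub>0: "correlated_counting_process \<Omega>\<^sub>0 M\<^sub>0 X\<^sub>0 F T 0"
    and pgf_M\<^sub>0: "\<And>u. u \<in> {-1..1} \<Longrightarrow>
          pgf \<Omega>\<^sub>0 M\<^sub>0 u = mittag_leffler \<nu> 1 (- (ln ((1 - (1 - p) * u) / p) powr \<alpha>))"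
  shows "(\<forall>t\<in>{0..T}. \<forall>k.
           \<P>(\<omega> in \<Omega>. counting_process M X t \<omega> = k) =
             (1 - \<rho>) * \<P>(\<omega> in \<Omega>\<^sub>0. counting_process M\<^sub>0 X\<^sub>0 t \<omega> = k) +
             \<rho> * ((1 / p - 1 / q t) / (1 / p - 1) * (if k = 0 then 1 else 0) +
                  (1 / q t - 1) / (1 / p - 1) *
                    \<P>(\<omega> in \<Omega>\<^sub>0. counting_process M\<^sub>0 X\<^sub>0 T \<omega> = k))) \<and>
    (\<forall>t\<in>{0..T}.
           \<P>(\<omega> in \<Omega>\<^sub>0. counting_process M\<^sub>0 X\<^sub>0 t \<omega> = 0) =
             mittag_leffler \<nu> 1 (- (ln (1 + A t) powr \<alpha>))) \<and>
    (\<forall>t\<in>{0..T}. \<forall>k\<ge>1.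
           \<P>(\<omega> in \<Omega>\<^sub>0. counting_process M\<^sub>0 X\<^sub>0 t \<omega> = k) =
             1 / fact k * ((- A t) ^ k / (1 + A t) ^ k) *
             (\<Sum>h = 1..k. ln (1 + A t) powi (- int h) * of_int (signed_stirling k h) *
                fox_wright [(1, \<alpha>), (1, 1)] [(1 - real h, \<alpha>), (1, \<nu>)]
                  (- (ln (1 + A t) powr \<alpha>))))"
proof -
  have A_eq: "A t = (1 / p - 1) * F t" if "t \<in> {0..T}" for t
    using p by (simp add: A[OF that] F[OF that])
  have F_compl: "(1 / p - 1 / q t) / (1 / p - 1) = 1 - F t" if "t \<in> {0..T}" for t
  proof -
    have "1 / p - 1 \<noteq> 0"
      using p by simp
    then show ?thesis
      unfolding F[OF that] by (simp add: diff_divide_eq_iff)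
  qed
  have "\<alpha> > 0" "\<nu> > 0"
    using alpha nu by auto
  note pmf0 = uncorrelated_pmf[OF process\<^sub>0 p this pgf_M\<^sub>0 _ A_eq]
  have "\<P>(\<omega> in \<Omega>. counting_process M X t \<omega> = k) =
      (1 - \<rho>) * \<P>(\<omega> in \<Omega>\<^sub>0. counting_process M\<^sub>0 X\<^sub>0 t \<omega> = k) +
      \<rho> * ((1 / p - 1 / q t) / (1 / p - 1) * (if k = 0 then 1 else 0) +
        (1 / q t - 1) / (1 / p - 1) *
          \<P>(\<omega> in \<Omega>\<^sub>0. counting_process M\<^sub>0 X\<^sub>0 T \<omega> = k))" if "t \<in> {0..T}" for t k
    using mixture_pmf[OF process process\<^sub>0 _ that, of k] pgf_M pgf_M\<^sub>0
    unfolding F_compl[OF that] F[OF that, symmetric] by simp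
  moreover have "\<P>(\<omega> in \<Omega>\<^sub>0. counting_process M\<^sub>0 X\<^sub>0 t \<omega> = 0) =
      mittag_leffler \<nu> 1 (- (ln (1 + A t) powr \<alpha>))" if "t \<in> {0..T}" for t
    using pmf0[OF _ that that, of 0] alpha by (simp add: fw_0)
  moreover have "\<P>(\<omega> in \<Omega>\<^sub>0. counting_process M\<^sub>0 X\<^sub>0 t \<omega> = k) =
      1 / fact k * ((- A t) ^ k / (1 + A t) ^ k) *
      (\<Sum>h = 1..k. ln (1 + A t) powi (- int h) * of_int (signed_stirling k h) *
        fox_wright [(1, \<alpha>), (1, 1)] [(1 - real h, \<alpha>), (1, \<nu>)] (- (ln (1 + A t) powr \<alpha>)))"
    if "t \<in> {0..T}" "k \<ge> 1" for t k
  proof -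
    let ?L = "ln (1 + A t)"
    \<comment> \<open>For k at least 1 the term h = 0 drops out, so the sum may start at 1.\<close>
    have "signed_stirling k 0 = 0"
      using \<open>k \<ge> 1\<close> by (cases k) auto
    then have "(\<Sum>h\<le>k. of_int (signed_stirling k h) * (fw \<alpha> \<nu> h (- (?L powr \<alpha>)) / ?L ^ h)) =
      (\<Sum>h = 1..k. of_int (signed_stirling k h) * (fw \<alpha> \<nu> h (- (?L powr \<alpha>)) / ?L ^ h))"
      by (intro sum.mono_neutral_right) (auto simp: Suc_le_eq)
    also have "\<dots> = (\<Sum>h = 1..k. ?L powi (- int h) * of_int (signed_stirling k h) *
        fox_wright [(1, \<alpha>), (1, 1)] [(1 - real h, \<alpha>), (1, \<nu>)] (- (?L powr \<alpha>)))"
      \<comment> \<open>Negative integer powers agree with division by the positive power even when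
        the logarithm is 0, since \<open>inverse 0 = 0\<close>.\<close>
      by (intro sum.cong) (auto simp: fw_def power_int_minus divide_inverse)
    finally show ?thesis
      using pmf0[OF _ that(1) that(1), of k] by simp
  qed
  ultimately show ?thesis
    by blast
qed

end
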